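(* Let $c_n=b_n-4W_n$ for $n\ge0$ and let $m\ge0$ be an integer. The double inequality $$\ln\left[\frac{4}{r'}+\sum_{n=0}^{m}c_nr^{2n}-\left(\sum_{n=0}^{m}c_n\right)r^{2m+2}\right]<\mathcal{K}(r)<\ln\left[\frac{4}{r'}+\sum_{n=0}^{m+1}c_nr^{2n}\right]$$ holds for all $r\in(0,1)$, and the lower and upper bounds are sharp, in the sense that the coefficients of $r^{2m+2}$ are best possible: the constant $-\sum_{n=0}^m c_n$ in the lower bound cannot be replaced by a larger constant, and the constant $c_{m+1}$ multiplying $r^{2m+2}$ in the upper bound cannot be replaced by a smaller one.
   Context: $\mathcal{K}(r)=\int_0^{\pi/2}\frac{dt}{\sqrt{1-r^2\sin^2 t}}$ for $r\in(0,1)$ is the complete elliptic integral of the first kind, so that $\mathcal{K}(\sqrt{x})=\frac{\pi}{2}\sum_{n=0}^\infty W_n^2x^n$ for $x\in(0,1)$, where $W_n=\frac{(2n-1)!!}{(2n)!!}=\frac{\Gamma(n+1/2)}{\Gamma(1/2)\Gamma(n+1)}$ (so $W_0=1$); the $W_n$ are the Maclaurin coefficients of $1/\sqrt{1-x}=\sum_{n=0}^\infty W_nx^n$. The numbers $b_n$ ($n\ge0$) are the Maclaurin coefficients of $e^{\mathcal{K}(\sqrt{x})}=\sum_{n=0}^\infty b_nx^n$ on $(0,1)$. Notation: $r'=\sqrt{1-r^2}$. *)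

theory Defs
  imports "HOL-Analysis.Analysis"
begin

definition elliptic_K :: "real \<Rightarrow> real" where
  "elliptic_K r = integral {0..pi/2} (\<lambda>t. 1 / sqrt (1 - r\<^sup>2 * (sin t)\<^sup>2))"

definition W :: "nat \<Rightarrow> real" where
  "W n = Gamma (real n + 1/2) / (Gamma (1/2) * Gamma (real n + 1))"

text \<open>
  The Maclaurin coefficients of \<open>exp (elliptic_K (sqrt x))\<close>, as the unique coefficient sequence
  whose power series represents this function on the open interval from 0 to 1. Iterated
  derivatives at 0 would not do: since \<open>sqrt (- x) = - sqrt x\<close>, the total function
  \<open>\<lambda>x. exp (elliptic_K (sqrt x))\<close> is even and not differentiable at 0.
\<close>
definition b :: "nat \<Rightarrow> real" where
  "b = (THE a. \<forall>x\<in>{0<..<1}. (\<lambda>n. a n * x ^ n) sums exp (elliptic_K (sqrt x)))"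

definition c :: "nat \<Rightarrow> real" where
  "c n = b n - 4 * W n"

end

theory Submission
  imports Defs "HOL-Real_Asymp.Real_Asymp"
begin

text \<open>
  Put \<open>x = r\<^sup>2\<close> and \<open>f = exp K - 4 / sqrt (1 - x)\<close>, so that \<open>c n\<close> are the Maclaurin coefficients of \<open>f\<close>
  in \<open>x\<close>. Everything follows from two facts: \<open>c n < 0\<close> for all \<open>n \<ge> 1\<close> (\<open>c_neg\<close>), and \<open>f\<close> tends to \<open>0\<close> at \<open>1\<close>
  (\<open>exp_elliptic_K_minus_pole_tendsto_0\<close>). By the first, the normalised remainder
  \<open>tail k r = (\<Sum>n. c (n + k) * x ^ n)\<close> is, for \<open>k \<ge> 1\<close>, negative and strictly decreasing in \<open>r\<close>; its limit at \<open>0\<close> is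
  \<open>c k\<close>, and by the second its limit at \<open>1\<close> is \<open>- (\<Sum>n<k. c n)\<close>. With \<open>k = m + 1\<close>, the lower bound replaces
  the remainder by its limit at \<open>1\<close>, the upper bound by its limit at \<open>0\<close>, and the limits show that
  neither constant can be improved.

  The limit at \<open>1\<close> comes from \<open>L \<le> K r\<close> and \<open>r * K r \<le> L\<close> with \<open>L = ln (2 * (1 + r) / sqrt (1 - r\<^sup>2))\<close>,
  obtained by splitting an elementary singular part off the integrand (\<open>elliptic_K_log_bounds\<close>).

  For the sign of \<open>c n = b n - 4 * W n\<close>, it is shown that \<open>b n / W n\<close> increases strictly for \<open>n \<ge> 1\<close>
  (\<open>B_ratio_gt\<close>, where \<open>B\<close> is \<open>b\<close> in recursive form); as the generating functions of \<open>b\<close> and \<open>W\<close>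
  have ratio tending to \<open>4\<close> at \<open>1\<close>, no quotient with \<open>n \<ge> 1\<close> can reach \<open>4\<close>. The monotonicity is a statement about the recursion
  \<open>(n + 1) * b (n + 1) = (\<Sum>k\<le>n. tau k * b (n - k))\<close>, which is the equation \<open>(exp K)' = K' * exp K\<close> in terms of
  coefficients, compared with \<open>(n + 1) * W (n + 1) = (n + 1 / 2) * W n\<close>. The coefficients \<open>tau k\<close> of \<open>K'\<close>
  increase to \<open>1 / 2\<close>, and their defects \<open>delta k = 1 / 2 - tau k\<close> decay, in relative terms, at least as fast as
  \<open>1 / (k + 6 / 5)\<close> (\<open>delta_ratio_ge\<close>). Combined with the fact that \<open>b\<close> is decreasing (\<open>B_decreasing\<close>),
  this suffices.
\<close>

section \<open>The Wallis numbers and the coefficients of K'\<close>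

lemma W_0 [simp]: "W 0 = 1"
  by (simp add: W_def Gamma_one_half_real)

lemma W_Suc: "W (Suc n) = W n * (2 * real n + 1) / (2 * real n + 2)"
proof -
  have G1: "Gamma (real n + 1/2 + 1) = (real n + 1/2) * Gamma (real n + 1/2)"
    by (rule Gamma_plus1) (auto elim!: nonpos_Ints_cases)
  have G2: "Gamma (real n + 1 + 1) = (real n + 1) * Gamma (real n + 1)"
    by (rule Gamma_plus1) (auto elim!: nonpos_Ints_cases)
  have frac: "(x + 1/2) * g / (s * ((x + 1) * h)) = g / (s * h) * (2 * x + 1) / (2 * x + 2)"
    if "x \<ge> 0" for x g h s :: real
  proof -
    have "(x + 1/2) / (x + 1) = (2 * x + 1) / (2 * x + 2)"
      using that by (simp add: field_simps)
    moreover have "(x + 1/2) * g / (s * ((x + 1) * h)) = g / (s * h) * ((x + 1/2) / (x + 1))"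
      by (simp add: mult_ac)
    ultimately show ?thesis by simp
  qed
  have "W (Suc n) = (real n + 1/2) * Gamma (real n + 1/2) / (Gamma (1/2) * ((real n + 1) * Gamma (real n + 1)))"
    using G1 G2 by (simp add: W_def add_ac)
  also have "\<dots> = W n * (2 * real n + 1) / (2 * real n + 2)"
    unfolding W_def by (rule frac) simp
  finally show ?thesis .
qed

lemma W_pos: "W n > 0"
  by (induction n) (auto simp: W_Suc)

text \<open>
  With \<open>x = r\<^sup>2\<close>, these are the Maclaurin coefficients of the derivative of \<open>K (sqrt x)\<close>.
\<close>
definition tau :: "nat \<Rightarrow> real" where
  "tau k = pi / 2 * real (Suc k) * (W (Suc k))\<^sup>2"

lemma tau_0: "tau 0 = pi / 8"
  by (simp add: tau_def W_Suc power2_eq_square)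

lemma tau_pos: "tau k > 0"
  using W_pos[of "Suc k"] by (simp add: tau_def)

lemma tau_Suc: "tau (Suc k) = tau k * (1 + 1 / (4 * (real k + 1) * (real k + 2)))"
proof -
  have "W (Suc (Suc k)) = W (Suc k) * (2 * real k + 3) / (2 * real k + 4)"
    by (subst W_Suc) (simp add: algebra_simps)
  hence "tau (Suc k) = pi / 2 * (real k + 2) * (W (Suc k) * (2 * real k + 3) / (2 * real k + 4))\<^sup>2"
    by (simp add: tau_def)
  also have "\<dots> = tau k * (1 + 1 / (4 * (real k + 1) * (real k + 2)))"
    by (simp add: tau_def divide_simps power2_eq_square) (simp add: algebra_simps)
  finally show ?thesis .
qed

text \<open>
  Both factors change by reciprocal amounts from \<open>n\<close> to \<open>n + 1\<close>, so the square of \<open>W n\<close> is governed by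
  Wallis' product for \<open>\<pi> / 2\<close>.
\<close>
lemma W_square_wallis: "(W n)\<^sup>2 * (2 * real n + 1) * (\<Prod>k=1..n. (4 * real k ^ 2) / (4 * real k ^ 2 - 1)) = 1"
proof (induction n)
  case (Suc n)
  have *: "4 * (real n + 1)\<^sup>2 - 1 = (2 * real n + 1) * (2 * real n + 3)"
    by (simp add: power2_eq_square algebra_simps)
  have key: "(W (Suc n))\<^sup>2 * (2 * real (Suc n) + 1) * (4 * real (Suc n) ^ 2 / (4 * real (Suc n) ^ 2 - 1))
        = (W n)\<^sup>2 * (2 * real n + 1)" (is "?l = _")
  proof -
    have "?l = (W n * (2 * real n + 1) / (2 * real n + 2))\<^sup>2 * (2 * real n + 3) *
        (4 * (real n + 1)\<^sup>2 / ((2 * real n + 1) * (2 * real n + 3)))"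
      using * by (simp add: W_Suc add_ac)
    also have "\<dots> = (W n)\<^sup>2 * (2 * real n + 1)"
      by (simp add: divide_simps power2_eq_square) (simp add: algebra_simps)
    finally show ?thesis .
  qed
  have split: "(\<Prod>k=1..Suc n. (4 * real k ^ 2) / (4 * real k ^ 2 - 1))
     = 4 * real (Suc n) ^ 2 / (4 * real (Suc n) ^ 2 - 1) * (\<Prod>k=1..n. (4 * real k ^ 2) / (4 * real k ^ 2 - 1))"
    (is "_ = ?t * ?p") by (rule prod.nat_ivl_Suc') simp
  have "(W (Suc n))\<^sup>2 * (2 * real (Suc n) + 1) * (?t * ?p)
      = (W (Suc n))\<^sup>2 * (2 * real (Suc n) + 1) * ?t * ?p"
    by (rule mult.assoc [symmetric])
  also have "\<dots> = (W n)\<^sup>2 * (2 * real n + 1) * ?p"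
    by (simp only: key)
  also have "\<dots> = 1" by (rule Suc.IH)
  finally show ?case by (simp only: split)
qed auto

lemma tau_tendsto: "tau \<longlonglongrightarrow> 1 / 2"
proof -
  let ?P = "\<lambda>n. \<Prod>k=1..n. (4 * real k ^ 2) / (4 * real k ^ 2 - 1)"
  have P: "(\<lambda>n. ?P (Suc n)) \<longlonglongrightarrow> pi / 2"
    using wallis by (rule LIMSEQ_Suc)
  have "(\<lambda>n. pi / 2 * (real (Suc n) / (2 * real (Suc n) + 1)) / ?P (Suc n)) \<longlonglongrightarrow> pi / 2 * (1 / 2) / (pi / 2)"
    by (intro tendsto_divide[OF _ P] tendsto_mult tendsto_const) (real_asymp, simp)
  moreover have "pi / 2 * (real (Suc n) / (2 * real (Suc n) + 1)) / ?P (Suc n) = tau n" for n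
  proof -
    have *: "(W (Suc n))\<^sup>2 * (2 * real (Suc n) + 1) * ?P (Suc n) = 1" by (rule W_square_wallis)
    have "x * y * p = 1 \<Longrightarrow> y > 0 \<Longrightarrow> c * (k / y) / p = c * k * x" for x y p c k :: real
    proof -
      assume "x * y * p = 1" "y > 0"
      hence "x = 1 / (y * p)" by (auto simp: eq_divide_eq mult_ac)
      thus ?thesis by simp
    qed
    from this[OF *, of "pi / 2" "real (Suc n)"] show ?thesis
      unfolding tau_def by (simp only: of_nat_0_less_iff zero_less_Suc mult_2 add_pos_pos zero_less_one)
  qed
  ultimately show ?thesis by simp
qed

lemma tau_strict_mono: "strict_mono tau"
  by (rule strict_monoI_Suc) (use tau_pos in \<open>simp add: tau_Suc\<close>)

lemma tau_less_half: "tau k < 1 / 2"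
proof -
  have "tau k < tau (Suc k)" using tau_strict_mono by (simp add: strict_mono_def)
  also have "\<dots> \<le> 1 / 2"
    by (rule incseq_le[OF strict_mono_mono[OF tau_strict_mono] tau_tendsto])
  finally show ?thesis .
qed

text \<open>
  The derivative of \<open>- ln (1 - x) / 2\<close> has all coefficients equal to \<open>1 / 2\<close>. Hence
  \<open>delta\<close> collects the coefficients of the derivative of \<open>- ln (1 - x) / 2 - K (sqrt x)\<close>, that is, of
  minus the logarithmic derivative of \<open>exp (K (sqrt x)) * sqrt (1 - x)\<close>.
\<close>
definition delta :: "nat \<Rightarrow> real" where
  "delta k = 1 / 2 - tau k"

lemma delta_pos: "delta k > 0"
  using tau_less_half[of k] by (simp add: delta_def)

text \<open>
  Since \<open>delta k\<close> is asymptotic to \<open>1 / (8 * k)\<close>, \<open>tau\<close> times a suitable factor \<open>1 + 1 / (4 * k) + \<dots>\<close> approaches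
  its limit \<open>1 / 2\<close> from above instead of from below. The shift \<open>11 / 5 = 6 / 5 + 1\<close> makes the corrected
  sequence decreasing from the start: its first two terms coincide. The lower bound that follows is
  equivalent to the comparison of consecutive \<open>delta\<close> in \<open>delta_Suc_scaled_le\<close>.
\<close>
lemma tau_corrected_ge_half:
  "tau k * (1 + (real k + 11/5) / (4 * (real k + 1) * (real k + 2))) \<ge> 1 / 2"
proof -
  define R where "R k = tau k * (1 + (real k + 11/5) / (4 * (real k + 1) * (real k + 2)))" for k
  have "decseq R"
  proof (rule decseq_SucI)
    fix k
    let ?x = "real k"
    have "(1 + 1 / (4 * (?x + 1) * (?x + 2))) * (1 + (?x + 16/5) / (4 * (?x + 2) * (?x + 3)))
          \<le> 1 + (?x + 11/5) / (4 * (?x + 1) * (?x + 2))"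
    proof -
      let ?A = "?x + 1" and ?B = "?x + 2" and ?C = "?x + 3"
      have "(1 + 1 / (4 * ?A * ?B)) * (1 + (?x + 16/5) / (4 * ?B * ?C))
          = ((4 * ?A * ?B + 1) * (4 * ?B * ?C + ?x + 16/5)) / (16 * ?A * ?B * ?B * ?C)"
        by (simp add: divide_simps) (simp add: algebra_simps)
      moreover have "1 + (?x + 11/5) / (4 * ?A * ?B)
          = ((4 * ?A * ?B + ?x + 11/5) * (4 * ?B * ?C)) / (16 * ?A * ?B * ?B * ?C)"
        by (simp add: divide_simps) (simp add: algebra_simps)
      moreover have "(4 * ?A * ?B + 1) * (4 * ?B * ?C + ?x + 16/5) \<le> (4 * ?A * ?B + ?x + 11/5) * (4 * ?B * ?C)"
      proof -
        have "(4 * ?A * ?B + ?x + 11/5) * (4 * ?B * ?C) - (4 * ?A * ?B + 1) * (4 * ?B * ?C + ?x + 16/5)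
            = 3 * ?x / 5"
          by (simp add: algebra_simps)
        thus ?thesis by (smt (verit) divide_nonneg_nonneg mult_nonneg_nonneg of_nat_0_le_iff)
      qed
      ultimately show ?thesis
        by (simp only:) (intro divide_right_mono, auto)
    qed
    hence "tau k * ((1 + 1 / (4 * (?x + 1) * (?x + 2))) * (1 + (?x + 16/5) / (4 * (?x + 2) * (?x + 3))))
          \<le> tau k * (1 + (?x + 11/5) / (4 * (?x + 1) * (?x + 2)))"
      using tau_pos[of k] by (intro mult_left_mono) auto
    thus "R (Suc k) \<le> R k"
      by (simp add: R_def tau_Suc add_ac mult_ac)
  qed
  moreover have "R \<longlonglongrightarrow> 1 / 2 * 1"
    unfolding R_def by (intro tendsto_mult tau_tendsto) real_asymp
  ultimately have "1 / 2 * 1 \<le> R k" by (rule decseq_ge)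
  thus ?thesis by (simp add: R_def)
qed

lemma delta_Suc_scaled_le: "(real (Suc k) + 6/5) * delta (Suc k) \<le> (real k + 6/5) * delta k"
proof -
  have "1 / 2 \<le> tau k * (1 + (real k + 11/5) / (4 * (real k + 1) * (real k + 2)))"
    by (rule tau_corrected_ge_half)
  thus ?thesis
    by (simp add: delta_def tau_Suc divide_simps) (simp add: algebra_simps)
qed

text \<open>
  The shift \<open>6 / 5\<close> has to be large enough for \<open>(k + 6 / 5) * delta k\<close> to decrease already from \<open>k = 0\<close>
  to \<open>k = 1\<close>, and smaller than \<open>2 - pi / 4\<close> for the estimate \<open>weighted_decrements_gt\<close> to be strong
  enough in \<open>B_ratio_gt\<close>. The admissible window, about 1.186 to 1.215, is narrow.
\<close>
lemma delta_ratio_ge: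
  assumes "j \<le> n"
  shows "delta n * (1 + real j / (real (n - j) + 6/5)) \<le> delta (n - j)"
proof -
  have "decseq (\<lambda>k. (real k + 6/5) * delta k)"
    by (rule decseq_SucI) (rule delta_Suc_scaled_le)
  hence "(real n + 6/5) * delta n \<le> (real (n - j) + 6/5) * delta (n - j)"
    by (rule decseqD) simp
  moreover have "1 + real j / (real (n - j) + 6/5) = (real n + 6/5) / (real (n - j) + 6/5)"
    using assms by (simp add: field_simps of_nat_diff)
  ultimately show ?thesis
    by (simp add: field_simps)
qed

lemma tau_diff_le: "tau (Suc k) - tau k \<le> 1 / (8 * (real k + 1) * (real k + 2))"
proof -
  have "tau (Suc k) - tau k = tau k / (4 * (real k + 1) * (real k + 2))"
    by (simp add: tau_Suc algebra_simps)
  also have "\<dots> \<le> (1/2) / (4 * (real k + 1) * (real k + 2))"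
    using tau_less_half[of k] by (intro divide_right_mono) auto
  finally show ?thesis by (simp add: algebra_simps)
qed

section \<open>The coefficients of exp K\<close>

text \<open>
  The recursion expresses the differential equation \<open>F' = K' * F\<close> for \<open>F = exp K\<close> as functions of
  \<open>x = r\<^sup>2\<close>; the lemma \<open>b_eq_B\<close> identifies the sequence with the Maclaurin coefficients \<open>b\<close>. The recursive
  form yields all estimates without reference to the function.
\<close>
fun B :: "nat \<Rightarrow> real" where
  "B 0 = exp (pi / 2)"
| "B (Suc n) = (\<Sum>k\<le>n. tau k * B (n - k)) / real (Suc n)"

declare B.simps(2) [simp del]

lemma B_rec: "real (Suc n) * B (Suc n) = (\<Sum>k\<le>n. tau k * B (n - k))"
  by (simp add: B.simps(2))

lemma B_pos: "B n > 0"
proof (induction n rule: less_induct)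
  case (less n)
  show ?case
  proof (cases n)
    case (Suc m)
    have "(\<Sum>k\<le>m. tau k * B (m - k)) > 0"
      using less Suc by (intro sum_pos) (auto intro!: mult_pos_pos tau_pos)
    thus ?thesis by (simp add: Suc B.simps(2))
  qed simp
qed

lemma B_1: "B (Suc 0) = pi / 8 * B 0"
  by (simp add: B.simps(2) tau_0)

text \<open>
  Multiplying \<open>F' = K' * F\<close> by \<open>1 - x\<close> replaces the coefficients \<open>tau\<close> by their
  quickly decaying differences.
\<close>
lemma B_rec_diff:
  "real (Suc (Suc m)) * B (Suc (Suc m))
   = real (Suc m) * B (Suc m) + tau 0 * B (Suc m) + (\<Sum>k\<le>m. (tau (Suc k) - tau k) * B (m - k))"
proof -
  have "(\<Sum>k\<le>Suc m. tau k * B (Suc m - k)) = tau 0 * B (Suc m) + (\<Sum>k\<le>m. tau (Suc k) * B (m - k))"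
    by (subst sum.atMost_Suc_shift) simp
  thus ?thesis
    unfolding B_rec by (simp add: algebra_simps sum_subtractf)
qed

text \<open>
  Only the first term of the convolution in \<open>B_rec_diff\<close> is kept, with \<open>tau 0 = pi / 8 \<ge> 3 / 8\<close>.
\<close>
lemma B_growth: "(real n + 3/8) * B n \<le> real (Suc n) * B (Suc n)"
proof (cases n)
  case 0
  have "3 / 8 * B 0 \<le> pi / 8 * B 0"
    using pi_gt3 B_pos[of 0] by (intro mult_right_mono) auto
  thus ?thesis by (simp add: 0 B_1)
next
  case (Suc m)
  have "3 / 8 * B n \<le> tau 0 * B n"
    using pi_gt3 B_pos[of n] by (intro mult_right_mono) (auto simp: tau_0)
  moreover have "(\<Sum>k\<le>m. (tau (Suc k) - tau k) * B (m - k)) \<ge> 0"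
    using tau_strict_mono B_pos by (intro sum_nonneg mult_nonneg_nonneg) (auto simp: strict_mono_def less_imp_le)
  ultimately show ?thesis
    using B_rec_diff[of m] by (simp add: Suc algebra_simps)
qed

lemma B_le_scaled:
  assumes "j \<le> m"
  shows "(real j + 3/8) * B j \<le> real (Suc m) * B (Suc m)"
proof -
  have "incseq (\<lambda>n. real n * B n)"
  proof (rule incseq_SucI)
    fix n
    have "real n * B n \<le> (real n + 3/8) * B n"
      using B_pos[of n] by (intro mult_right_mono) auto
    also note B_growth
    finally show "real n * B n \<le> real (Suc n) * B (Suc n)" .
  qed
  hence "real (Suc j) * B (Suc j) \<le> real (Suc m) * B (Suc m)"
    using assms by (intro incseqD[of "\<lambda>n. real n * B n"]) auto
  with B_growth[of j] show ?thesis by linarith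
qed

lemma telescoping_reciprocals: "(\<Sum>k<m. 1 / ((real k + 1) * (real k + 2))) = 1 - 1 / (real m + 1)"
proof (induction m)
  case (Suc m)
  have "1 / (real m + 1) - 1 / (real m + 2) = 1 / ((real m + 1) * (real m + 2))"
    by (simp add: divide_simps)
  with Suc.IH show ?case by (simp add: add_ac)
qed auto

text \<open>
  For \<open>n \<ge> 1\<close>, by \<open>B_rec_diff\<close> the claim is that \<open>tau 0 * B n\<close> plus a convolution of the differences of \<open>tau\<close> with \<open>B\<close> is
  less than \<open>B n\<close>. The differences are at most \<open>1 / (8 * (k + 1) * (k + 2))\<close>, and the growth of
  \<open>n * B n\<close> bounds the earlier \<open>B j\<close> by multiples of \<open>B n\<close>. The three contributions are at most
  \<open>2 / 5\<close>, \<open>3 / 8\<close> and \<open>1 / 6\<close> times \<open>B n\<close>, which sum to less than \<open>1\<close>; the crude bound on \<open>B 0\<close>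
  makes it necessary to treat the last summand on its own.
\<close>
lemma B_decreasing: "B (Suc n) < B n"
proof (cases n)
  case 0
  have "pi / 8 * B 0 < 1 * B 0"
    using pi_less_4 B_pos[of 0] by (intro mult_strict_right_mono) auto
  thus ?thesis by (simp add: 0 B_1)
next
  case (Suc m)
  define v where "v = B (Suc m)"
  have v: "v > 0" by (simp add: v_def B_pos)
  have inner: "(tau (Suc k) - tau k) * B (m - k) \<le> 3 / 16 * (1 / ((real k + 1) * (real k + 2)) + 1 / (real m + 1)) * v"
    if "k < m" for k
  proof -
    obtain j where m: "m = j + k" and j: "j \<ge> 1"
      using \<open>k < m\<close> that[of "m - k"] by auto
    have "2 / 3 * (real j + 1) * B j \<le> (real j + 3/8) * B j"
      using B_pos[of j] j by (intro mult_right_mono) auto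
    also have "\<dots> \<le> (real m + 1) * v"
      using B_le_scaled[of j m] m by (simp add: v_def add_ac)
    finally have "B j \<le> 3 / 2 * (real m + 1) / (real j + 1) * v"
      by (simp add: field_simps)
    hence "(tau (Suc k) - tau k) * B j
        \<le> 1 / (8 * (real k + 1) * (real k + 2)) * (3 / 2 * (real m + 1) / (real j + 1) * v)"
      using B_pos[of j] by (intro mult_mono tau_diff_le) auto
    also have "\<dots> = 3 / 16 * ((real m + 1) / ((real k + 1) * (real k + 2) * (real j + 1))) * v"
      by (simp add: field_simps)
    also have "\<dots> \<le> 3 / 16 * (1 / ((real k + 1) * (real k + 2)) + 1 / (real m + 1)) * v"
    proof (intro mult_right_mono mult_left_mono)
      let ?k = "real k" and ?j = "real j"
      have "(?k + ?j + 1) / ((?k + 1) * (?k + 2) * (?j + 1))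
          \<le> (?k + ?j + 2) / ((?k + 1) * (?k + 2) * (?j + 1))"
        by (intro divide_right_mono) auto
      \<comment> \<open>partial fractions with respect to \<open>k + 1\<close> and \<open>j + 1\<close>\<close>
      also have "\<dots> = 1 / ((?k + 1) * (?k + 2)) + 1 / ((?k + 2) * (?j + 1))"
        by (simp add: divide_simps)
      also have "1 / ((?k + 2) * (?j + 1)) \<le> 1 / (?k + ?j + 1)"
        by (intro divide_left_mono mult_pos_pos) (auto simp: algebra_simps)
      finally show "(real m + 1) / ((?k + 1) * (?k + 2) * (?j + 1)) \<le> 1 / ((?k + 1) * (?k + 2)) + 1 / (real m + 1)"
        by (simp add: m add_ac)
    qed (use v in auto)
    finally show ?thesis by (simp add: m)
  qed
  have last: "(tau (Suc m) - tau m) * B 0 \<le> 1 / 6 * v"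
  proof -
    have "B 0 \<le> 8 / 3 * (real m + 1) * v"
      using B_le_scaled[of 0 m] by (simp add: v_def algebra_simps)
    hence "(tau (Suc m) - tau m) * B 0 \<le> 1 / (8 * (real m + 1) * (real m + 2)) * (8 / 3 * (real m + 1) * v)"
      using B_pos[of 0] by (intro mult_mono tau_diff_le) auto
    also have "\<dots> = 1 / (3 * (real m + 2)) * v"
      by (simp add: divide_simps)
    also have "\<dots> \<le> 1 / 6 * v"
      using v by (intro mult_right_mono divide_left_mono) auto
    finally show ?thesis .
  qed
  have "(\<Sum>k\<le>m. (tau (Suc k) - tau k) * B (m - k))
      = (\<Sum>k<m. (tau (Suc k) - tau k) * B (m - k)) + (tau (Suc m) - tau m) * B 0"
    by (simp add: lessThan_Suc_atMost [symmetric])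
  also have "(\<Sum>k<m. (tau (Suc k) - tau k) * B (m - k))
      \<le> (\<Sum>k<m. 3 / 16 * (1 / ((real k + 1) * (real k + 2)) + 1 / (real m + 1)) * v)"
    by (intro sum_mono inner) auto
  also have "\<dots> = 3 / 16 * ((\<Sum>k<m. 1 / ((real k + 1) * (real k + 2))) + real m / (real m + 1)) * v"
    by (simp only: sum_distrib_left [symmetric] sum_distrib_right [symmetric] sum.distrib) simp
  also have "\<dots> \<le> 3 / 16 * (1 + 1) * v"
    using v unfolding telescoping_reciprocals by (intro mult_right_mono mult_left_mono add_mono) auto
  also note last
  finally have "(\<Sum>k\<le>m. (tau (Suc k) - tau k) * B (m - k)) \<le> (3 / 8 + 1 / 6) * v"
    by (simp add: algebra_simps)
  moreover have "tau 0 * v \<le> 2 / 5 * v"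
    using pi_approx v by (intro mult_right_mono) (auto simp: tau_0)
  ultimately have "tau 0 * v + (\<Sum>k\<le>m. (tau (Suc k) - tau k) * B (m - k)) < v"
    using v by (simp only: distrib_right)
  hence "real (Suc m) * v + tau 0 * v + (\<Sum>k\<le>m. (tau (Suc k) - tau k) * B (m - k)) < real (Suc (Suc m)) * v"
    unfolding of_nat_Suc[of "Suc m"] distrib_right by linarith
  hence "real (Suc (Suc m)) * B (Suc (Suc m)) < real (Suc (Suc m)) * v"
    unfolding B_rec_diff v_def [symmetric] .
  thus ?thesis by (simp add: Suc v_def)
qed

lemma sum_weighted_decrements:
  "(\<Sum>i\<le>m. real (Suc i) * (B i - B (Suc i))) = (\<Sum>i\<le>m. B i) - real (Suc m) * B (Suc m)"
  by (induction m) (auto simp: algebra_simps)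

text \<open>
  Replacing every \<open>tau\<close> by its limit \<open>1 / 2\<close> in the recursion gives \<open>2 * (m + 1) * B (m + 1) \<le> (\<Sum>i\<le>m. B i)\<close>, and then
  \<open>sum_weighted_decrements\<close> gives the factor \<open>m + 1\<close>. Retaining the largest defect, \<open>delta 0\<close>, and using
  \<open>B m > B (m + 1)\<close> improves the factor by \<open>2 * delta 0 = 1 - pi / 4\<close>, which exceeds \<open>1 / 5\<close>.
\<close>
lemma weighted_decrements_gt:
  "(real m + 6/5) * B (Suc m) < (\<Sum>i\<le>m. real (Suc i) * (B i - B (Suc i)))"
proof -
  have "(\<Sum>k\<le>m. delta k * B (m - k)) \<ge> delta 0 * B (m - 0)"
    by (rule member_le_sum) (auto intro!: mult_nonneg_nonneg less_imp_le[OF delta_pos] less_imp_le[OF B_pos])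
  moreover have "(\<Sum>k\<le>m. B (m - k)) = (\<Sum>i\<le>m. B i)"
    by (simp add: sum.nat_diff_reindex lessThan_Suc_atMost [symmetric] sum.nat_diff_reindex[of B "Suc m", simplified])
  moreover have "(\<Sum>k\<le>m. tau k * B (m - k)) = (\<Sum>k\<le>m. B (m - k)) / 2 - (\<Sum>k\<le>m. delta k * B (m - k))"
    by (simp add: delta_def algebra_simps sum_subtractf sum_divide_distrib)
  ultimately have "real (Suc m) * B (Suc m) \<le> (\<Sum>i\<le>m. B i) / 2 - delta 0 * B m"
    unfolding B_rec by simp
  moreover have "1 / 5 * B (Suc m) < 2 * delta 0 * B m"
    using B_decreasing[of m] pi_approx B_pos[of m]
    by (intro mult_strict_mono) (auto simp: delta_def tau_0 less_imp_le B_pos)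
  ultimately show ?thesis
    unfolding sum_weighted_decrements by (simp add: algebra_simps)
qed

text \<open>
  Equivalently, \<open>B n / W n\<close> increases strictly for \<open>n \<ge> 1\<close>. Writing \<open>tau = 1 / 2 - delta\<close> in the
  recursion turns the claim into \<open>delta n * B 0 < (\<Sum>i<n. delta (n - 1 - i) * (B i - B (i + 1)))\<close>. Since \<open>B\<close> and
  \<open>delta\<close> decrease, bounding every \<open>delta\<close> on the right by \<open>delta n\<close> would give \<open>delta n * (B 0 - B n)\<close>,
  just short by \<open>delta n * B n\<close>. The quantitative decay \<open>delta_ratio_ge\<close> supplies additional weights, and
  \<open>weighted_decrements_gt\<close> shows that they more than make up for the deficit.
\<close>
lemma B_ratio_gt:
  assumes "n \<ge> 1"
  shows "(real n + 1 / 2) * B n < real (Suc n) * B (Suc n)"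
proof -
  obtain m where n: "n = Suc m" using assms by (cases n) auto
  let ?D = "\<lambda>i. B i - B (Suc i)"
  have D: "?D i > 0" for i using B_decreasing[of i] by simp
  have "(real m + 6/5) * B n < (\<Sum>i\<le>m. real (Suc i) * ?D i)"
    unfolding n by (rule weighted_decrements_gt)
  hence "B n < (\<Sum>i\<le>m. real (Suc i) * ?D i) / (real m + 6/5)"
    by (simp add: field_simps)
  also have "\<dots> \<le> (\<Sum>i\<le>m. real (Suc i) / (real (m - i) + 6/5) * ?D i)"
    unfolding sum_divide_distrib
  proof (rule sum_mono)
    fix i assume "i \<in> {..m}"
    have "real (Suc i) * ?D i / (real m + 6/5) \<le> real (Suc i) * ?D i / (real (m - i) + 6/5)"
      using D[of i] by (intro divide_left_mono) auto
    thus "real (Suc i) * ?D i / (real m + 6/5) \<le> real (Suc i) / (real (m - i) + 6/5) * ?D i"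
      by simp
  qed
  finally have *: "B n < (\<Sum>i\<le>m. real (Suc i) / (real (m - i) + 6/5) * ?D i)" .
  have "(\<Sum>i\<le>m. ?D i) = B 0 - B n"
    by (simp add: n sum_telescope)
  hence "delta n * B 0 = delta n * ((\<Sum>i\<le>m. ?D i) + B n)" by simp
  also have "\<dots> < delta n * ((\<Sum>i\<le>m. ?D i) + (\<Sum>i\<le>m. real (Suc i) / (real (m - i) + 6/5) * ?D i))"
    using * delta_pos[of n] by (intro mult_strict_left_mono) auto
  also have "\<dots> = (\<Sum>i\<le>m. delta n * (1 + real (Suc i) / (real (n - Suc i) + 6/5)) * ?D i)"
    by (simp add: n sum.distrib [symmetric] sum_distrib_left algebra_simps)
  also have "\<dots> \<le> (\<Sum>i\<le>m. delta (n - Suc i) * ?D i)"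
    using D by (intro sum_mono mult_right_mono delta_ratio_ge) (auto simp: n less_imp_le)
  also have "\<dots> = (\<Sum>k\<le>m. delta k * (B (m - k) - B (n - k)))"
    by (subst sum.atLeastAtMost_rev[of _ 0 m, unfolded atLeast0AtMost])
       (auto intro!: sum.cong simp: n Suc_diff_le)
  finally have "delta n * B 0 < (\<Sum>k\<le>m. delta k * (B (m - k) - B (n - k)))" .
  moreover have "real (Suc n) * B (Suc n) - real n * B n
      = B n / 2 - (delta n * B 0 - (\<Sum>k\<le>m. delta k * (B (m - k) - B (n - k))))"
  proof -
    have "(\<Sum>k\<le>n. B (n - k)) - (\<Sum>k\<le>m. B (m - k)) = B n"
      by (simp add: n sum.atMost_Suc_shift del: sum.atMost_Suc)
    moreover have "real (Suc n) * B (Suc n) = (\<Sum>k\<le>n. B (n - k)) / 2 - (\<Sum>k\<le>n. delta k * B (n - k))"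
      unfolding B_rec by (simp add: delta_def algebra_simps sum_subtractf sum_divide_distrib)
    moreover have "real n * B n = (\<Sum>k\<le>m. B (m - k)) / 2 - (\<Sum>k\<le>m. delta k * B (m - k))"
      unfolding n B_rec by (simp add: delta_def algebra_simps sum_subtractf sum_divide_distrib)
    moreover have "(\<Sum>k\<le>n. delta k * B (n - k)) = (\<Sum>k\<le>m. delta k * B (n - k)) + delta n * B 0"
      by (simp add: n)
    moreover have "(\<Sum>k\<le>m. delta k * (B (m - k) - B (n - k)))
        = (\<Sum>k\<le>m. delta k * B (m - k)) - (\<Sum>k\<le>m. delta k * B (n - k))"
      by (simp add: algebra_simps sum_subtractf)
    ultimately show ?thesis by linarith
  qed
  ultimately show ?thesis by (simp add: algebra_simps)
qed

section \<open>Power series of K and of exp K\<close>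

lemma summable_bounded_powser:
  fixes f :: "nat \<Rightarrow> real"
  assumes "\<And>n. \<bar>f n\<bar> \<le> C" "\<bar>x\<bar> < 1"
  shows "summable (\<lambda>n. norm (f n * x ^ n))"
proof (rule summable_comparison_test)
  show "summable (\<lambda>n. C * \<bar>x\<bar> ^ n)"
    using assms(2) by (intro summable_mult summable_geometric) auto
  show "\<exists>N. \<forall>n\<ge>N. norm (norm (f n * x ^ n)) \<le> C * \<bar>x\<bar> ^ n"
    using assms(1) by (auto simp: abs_mult power_abs intro!: mult_right_mono)
qed

lemma powser_tendsto_at_right_0:
  fixes a :: "nat \<Rightarrow> real"
  assumes "\<And>x. x \<in> {0<..<1} \<Longrightarrow> (\<lambda>n. a n * x ^ n) sums f x"
  shows "(f \<longlongrightarrow> a 0) (at_right 0)"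
proof -
  have "summable (\<lambda>n. a n * (1/2) ^ n)"
    using assms[of "1/2"] by (auto simp: sums_iff)
  hence "isCont (\<lambda>x. \<Sum>n. a n * x ^ n) 0"
    by (rule isCont_powser) auto
  hence "((\<lambda>x. \<Sum>n. a n * x ^ n) \<longlongrightarrow> a 0) (at 0)"
    by (simp add: isCont_def)
  hence "((\<lambda>x. \<Sum>n. a n * x ^ n) \<longlongrightarrow> a 0) (at_right 0)"
    by (rule tendsto_mono [OF at_le, rotated]) auto
  moreover have "\<forall>\<^sub>F x in at_right 0. (\<Sum>n. a n * x ^ n) = f x"
    using eventually_at_right_real[OF zero_less_one]
    by (rule eventually_mono) (use assms in \<open>auto simp: sums_iff\<close>)
  ultimately show ?thesis by (rule Lim_transform_eventually)
qed

lemma powser_sums_tail: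
  fixes a :: "nat \<Rightarrow> real"
  assumes "(\<lambda>n. a n * x ^ n) sums s" "x \<noteq> 0"
  shows "(\<lambda>n. a (n + k) * x ^ n) sums ((s - (\<Sum>n<k. a n * x ^ n)) / x ^ k)"
proof -
  have "(\<lambda>n. a (n + k) * x ^ (n + k)) sums (s - (\<Sum>n<k. a n * x ^ n))"
    using assms(1) by (rule sums_split_initial_segment)
  hence "(\<lambda>n. a (n + k) * x ^ (n + k) / x ^ k) sums ((s - (\<Sum>n<k. a n * x ^ n)) / x ^ k)"
    by (rule sums_divide)
  thus ?thesis using assms(2) by (simp add: power_add)
qed

text \<open>
  Coefficient \<open>k\<close> is the limit at \<open>0\<close> from the right of the normalised remainder after \<open>k\<close> terms, so
  knowledge of the function on the positive side suffices.
\<close>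
lemma powser_eq_on_unit_interval:
  fixes a d :: "nat \<Rightarrow> real"
  assumes "\<And>x. x \<in> {0<..<1} \<Longrightarrow> (\<lambda>n. a n * x ^ n) sums f x"
      and "\<And>x. x \<in> {0<..<1} \<Longrightarrow> (\<lambda>n. d n * x ^ n) sums f x"
  shows "a = d"
proof
  fix k show "a k = d k"
  proof (induction k rule: less_induct)
    case (less k)
    let ?g = "\<lambda>x. (f x - (\<Sum>n<k. a n * x ^ n)) / x ^ k"
    have "(?g \<longlongrightarrow> a (0 + k)) (at_right 0)"
      using assms(1) by (intro powser_tendsto_at_right_0 powser_sums_tail) auto
    moreover have "(\<Sum>n<k. a n * x ^ n) = (\<Sum>n<k. d n * x ^ n)" for x
      using less by simp
    hence "(?g \<longlongrightarrow> d (0 + k)) (at_right 0)"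
      using assms(2) by (intro powser_tendsto_at_right_0) (auto intro!: powser_sums_tail)
    ultimately show ?case
      by (intro tendsto_unique[of "at_right 0" ?g]) auto
  qed
qed

lemma W_sums:
  assumes "\<bar>x\<bar> < 1"
  shows "(\<lambda>n. W n * x ^ n) sums (1 / sqrt (1 - x))"
proof -
  have W: "W n = ((-1/2) gchoose n) * (-1) ^ n" for n
  proof (induction n)
    case (Suc n)
    have "real (Suc n) * ((-1/2) gchoose Suc n) = (-1/2 - real n) * ((-1/2) gchoose n)"
      using gbinomial_absorb_comp[of "-1/2::real" n] gbinomial_absorption[of n "-1/2::real"] by simp
    hence rec: "((-1/2) gchoose Suc n) = (-1/2 - real n) / (real n + 1) * ((-1/2) gchoose n)"
      by (simp add: field_simps)
    show ?case
      unfolding W_Suc Suc.IH rec by (simp add: divide_simps) (simp add: algebra_simps)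
  qed auto
  have "(\<lambda>n. ((-1/2) gchoose n) * (-x) ^ n) sums (1 + (-x)) powr (-1/2)"
    using assms by (intro gen_binomial_real) auto
  moreover have "(1 + (-x)) powr (-1/2) = 1 / sqrt (1 - x)"
    using assms by (simp add: powr_minus_divide powr_half_sqrt)
  moreover have "((-1/2) gchoose n) * (-x) ^ n = W n * x ^ n" for n
    by (subst power_minus) (simp add: W)
  ultimately show ?thesis by simp
qed

lemma W_le_1: "W n \<le> 1"
proof (induction n)
  case (Suc n)
  have "W n * ((2 * real n + 1) / (2 * real n + 2)) \<le> 1 * 1"
    using Suc.IH W_pos[of n] by (intro mult_mono) auto
  thus ?case by (simp add: W_Suc)
qed auto

lemma wallis_integral: "((\<lambda>t. sin t ^ (2 * n)) has_integral (pi / 2 * W n)) {0..pi/2}"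
proof (induction n)
  case 0
  show ?case using has_integral_const_real[of "1::real" 0 "pi/2"] by simp
next
  case (Suc n)
  let ?f = "\<lambda>t. sin t ^ (2 * n) :: real" and ?g = "\<lambda>t. sin t ^ (2 * Suc n) :: real"
  have "((\<lambda>t. (2 * real n + 2) * ?g t - (2 * real n + 1) * ?f t) has_integral
          (- cos (pi/2) * sin (pi/2) ^ (2 * n + 1) - (- cos 0 * sin 0 ^ (2 * n + 1)))) {0..pi/2}"
  proof (rule fundamental_theorem_of_calculus)
    fix t :: real
    have "((\<lambda>t. - cos t * sin t ^ (2 * n + 1)) has_real_derivative
             ((2 * real n + 2) * ?g t - (2 * real n + 1) * ?f t)) (at t)"
    proof -
      let ?P = "sin t ^ (2 * n)"
      have sc: "cos t * cos t = 1 - sin t * sin t"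
        using sin_squared_eq[of t] by (simp add: power2_eq_square algebra_simps)
      have "sin t * sin t * ?P - (2 * real n + 1) * ?P * (cos t * cos t)
          = (2 * real n + 2) * ?g t - (2 * real n + 1) * ?f t"
        unfolding sc by (simp add: algebra_simps)
      moreover have "((\<lambda>t. - cos t * sin t ^ (2 * n + 1)) has_real_derivative
          (sin t * sin t * ?P - (2 * real n + 1) * ?P * (cos t * cos t))) (at t)"
      proof -
        have "((\<lambda>t. sin t ^ Suc (2 * n)) has_real_derivative ((1 + of_nat (2 * n)) * (cos t * ?P))) (at t)"
          by (rule DERIV_power_Suc) (rule DERIV_sin)
        hence "((\<lambda>t. - cos t * sin t ^ Suc (2 * n)) has_real_derivative
            (- (- sin t) * sin t ^ Suc (2 * n) + (1 + of_nat (2 * n)) * (cos t * ?P) * - cos t)) (at t)"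
          by (intro DERIV_mult DERIV_minus DERIV_cos)
        thus ?thesis by (simp add: algebra_simps)
      qed
      ultimately show ?thesis by simp
    qed
    thus "((\<lambda>t. - cos t * sin t ^ (2 * n + 1)) has_vector_derivative
             ((2 * real n + 2) * ?g t - (2 * real n + 1) * ?f t)) (at t within {0..pi/2})"
      by (simp add: has_real_derivative_iff_has_vector_derivative has_vector_derivative_at_within)
  qed auto
  hence "((\<lambda>t. (2 * real n + 2) * ?g t - (2 * real n + 1) * ?f t) has_integral 0) {0..pi/2}"
    by simp
  from has_integral_add[OF this has_integral_mult_right[OF Suc.IH, of "2 * real n + 1"]]
  have "((\<lambda>t. (2 * real n + 2) * ?g t) has_integral ((2 * real n + 1) * (pi / 2 * W n))) {0..pi/2}"
    by simp
  from has_integral_mult_right[OF this, of "1 / (2 * real n + 2)"]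
  have "((\<lambda>t. 1 / (2 * real n + 2) * ((2 * real n + 2) * ?g t)) has_integral
          (1 / (2 * real n + 2) * ((2 * real n + 1) * (pi / 2 * W n)))) {0..pi/2}" .
  moreover have "1 / (2 * real n + 2) * ((2 * real n + 2) * ?g t) = ?g t" for t
    by (simp add: field_simps del: power_Suc mult_Suc_right)
  moreover have "1 / (2 * real n + 2) * ((2 * real n + 1) * (pi / 2 * W n)) = pi / 2 * W (Suc n)"
    by (simp add: W_Suc mult_ac)
  ultimately show ?case by (simp only:)
qed

text \<open>
  The binomial series of the integrand converges uniformly, with majorant \<open>W n * r ^ (2 * n)\<close>, and is
  integrated term by term with Wallis' integrals.
\<close>
lemma elliptic_K_sums:
  assumes "r \<in> {0<..<1}"
  shows "(\<lambda>n. pi / 2 * (W n)\<^sup>2 * (r\<^sup>2) ^ n) sums elliptic_K r"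
proof -
  define x where "x = r\<^sup>2"
  have x: "0 < x" "x < 1" using assms by (auto simp: x_def power_less_one_iff)
  let ?f = "\<lambda>n t. W n * x ^ n * sin t ^ (2 * n)"
  have sin_le: "(sin t)\<^sup>2 \<le> 1" for t :: real
    using abs_sin_le_one[of t] by (simp add: abs_square_le_1)
  have "uniform_limit {0..pi/2} (\<lambda>N t. \<Sum>n<N. ?f n t) (\<lambda>t. \<Sum>n. ?f n t) sequentially"
  proof (rule Weierstrass_m_test)
    show "norm (?f n t) \<le> W n * x ^ n" for n t
      using W_pos[of n] x power_le_one[OF _ sin_le, of t n]
      by (simp add: abs_mult power_mult mult_left_le)
    show "summable (\<lambda>n. W n * x ^ n)"
      using W_sums[of x] x by (simp add: sums_iff)
  qed
  moreover have "(\<Sum>n. ?f n t) = 1 / sqrt (1 - r\<^sup>2 * (sin t)\<^sup>2)" for t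
  proof -
    have "x * (sin t)\<^sup>2 \<le> x" using x sin_le[of t] by (simp add: mult_left_le)
    hence "x * (sin t)\<^sup>2 < 1" using x by linarith
    hence "\<bar>x * (sin t)\<^sup>2\<bar> < 1" using x by (simp add: abs_mult)
    hence "(\<lambda>n. W n * (x * (sin t)\<^sup>2) ^ n) sums (1 / sqrt (1 - x * (sin t)\<^sup>2))"
      by (rule W_sums)
    also have "(\<lambda>n. W n * (x * (sin t)\<^sup>2) ^ n) = (\<lambda>n. ?f n t)"
      by (simp only: power_mult_distrib power_mult mult.assoc)
    finally show ?thesis by (simp add: sums_iff x_def)
  qed
  ultimately have ul: "uniform_limit {0..pi/2} (\<lambda>N t. \<Sum>n<N. ?f n t) (\<lambda>t. 1 / sqrt (1 - r\<^sup>2 * (sin t)\<^sup>2)) sequentially"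
    by simp
  obtain I J where IJ: "\<And>N. ((\<lambda>t. \<Sum>n<N. ?f n t) has_integral I N) {0..pi/2}"
      "((\<lambda>t. 1 / sqrt (1 - r\<^sup>2 * (sin t)\<^sup>2)) has_integral J) {0..pi/2}" "I \<longlonglongrightarrow> J"
    by (rule uniform_limit_integral[OF ul]) (auto intro!: continuous_intros)
  have "((\<lambda>t. \<Sum>n<N. ?f n t) has_integral (\<Sum>n<N. W n * x ^ n * (pi / 2 * W n))) {0..pi/2}" for N
    by (intro has_integral_sum has_integral_mult_right wallis_integral) auto
  with IJ(1) have "I N = (\<Sum>n<N. W n * x ^ n * (pi / 2 * W n))" for N
    by (rule has_integral_unique)
  hence "I = (\<lambda>N. \<Sum>n<N. W n * x ^ n * (pi / 2 * W n))" by (rule ext)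
  moreover have "J = elliptic_K r"
    unfolding elliptic_K_def using IJ(2) by (simp add: integral_unique)
  ultimately have "(\<lambda>n. W n * x ^ n * (pi / 2 * W n)) sums elliptic_K r"
    using IJ(3) unfolding sums_def by (simp only:)
  thus ?thesis by (simp add: x_def power2_eq_square mult_ac)
qed

lemma B_le_B_0: "B n \<le> B 0"
  using decseq_SucI[of B] B_decreasing by (intro decseqD[of B]) (auto simp: less_imp_le)

text \<open>
  The Cauchy product shows that the series \<open>F\<close> of \<open>B\<close> satisfies \<open>F' = A' * F\<close>, where \<open>A\<close> is the series in the
  exponent. Hence \<open>F * exp (- A)\<close> is constant, and its value at \<open>0\<close> is \<open>1\<close>.
\<close>
lemma B_sums_exp:
  assumes "\<bar>x\<bar> < 1"
  shows "(\<lambda>n. B n * x ^ n) sums exp (\<Sum>n. pi / 2 * (W n)\<^sup>2 * x ^ n)"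
proof -
  let ?a = "\<lambda>n. pi / 2 * (W n)\<^sup>2"
  define A where "A = (\<lambda>x. \<Sum>n. ?a n * x ^ n)"
  define F where "F = (\<lambda>x. \<Sum>n. B n * x ^ n)"
  have sum_a: "summable (\<lambda>n. norm (?a n * x ^ n))" if "\<bar>x\<bar> < 1" for x
  proof (rule summable_bounded_powser[OF _ that])
    show "\<bar>?a n\<bar> \<le> pi / 2 * 1" for n
      using W_pos[of n] W_le_1[of n] by (simp add: abs_mult power_le_one)
  qed
  have sum_tau: "summable (\<lambda>n. norm (tau n * x ^ n))" if "\<bar>x\<bar> < 1" for x
    by (rule summable_bounded_powser[OF _ that, where C = "1/2"])
       (use tau_pos tau_less_half in \<open>auto simp: abs_le_iff less_imp_le intro: less_trans[of _ 0]\<close>)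
  have sum_B: "summable (\<lambda>n. norm (B n * x ^ n))" if "\<bar>x\<bar> < 1" for x
    by (rule summable_bounded_powser[OF _ that, where C = "B 0"])
       (use B_pos B_le_B_0 in \<open>auto simp: abs_of_pos\<close>)
  have diffs_a: "diffs ?a = tau"
    by (simp add: fun_eq_iff diffs_def tau_def)
  have dA: "(A has_real_derivative (\<Sum>n. tau n * x ^ n)) (at x)" if "\<bar>x\<bar> < 1" for x
    unfolding A_def diffs_a [symmetric] using that
    by (intro termdiffs_strong'[where K = 1] summable_norm_cancel[OF sum_a]) auto
  have dF: "(F has_real_derivative (\<Sum>n. tau n * x ^ n) * F x) (at x)" if "\<bar>x\<bar> < 1" for x
  proof -
    have "(F has_real_derivative (\<Sum>n. diffs B n * x ^ n)) (at x)"
      unfolding F_def using that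
      by (intro termdiffs_strong'[where K = 1] summable_norm_cancel[OF sum_B]) auto
    also have "(\<Sum>n. diffs B n * x ^ n) = (\<Sum>n. \<Sum>k\<le>n. (tau k * x ^ k) * (B (n - k) * x ^ (n - k)))"
    proof (rule suminf_cong)
      fix n
      have "diffs B n * x ^ n = (\<Sum>k\<le>n. tau k * B (n - k)) * x ^ n"
        using B_rec[of n] by (simp add: diffs_def)
      also have "\<dots> = (\<Sum>k\<le>n. (tau k * x ^ k) * (B (n - k) * x ^ (n - k)))"
        unfolding sum_distrib_right
        by (intro sum.cong refl) (simp add: power_add [symmetric])
      finally show "diffs B n * x ^ n = (\<Sum>k\<le>n. (tau k * x ^ k) * (B (n - k) * x ^ (n - k)))" .
    qed
    also have "\<dots> = (\<Sum>n. tau n * x ^ n) * F x"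
      unfolding F_def by (rule Cauchy_product [symmetric]) (use that sum_tau sum_B in auto)
    finally show ?thesis .
  qed
  have const: "F x * exp (- A x) = F 0 * exp (- A 0)"
  proof (rule DERIV_isconst3[of "-1" 1 x 0 "\<lambda>x. F x * exp (- A x)"])
    fix y :: real assume "y \<in> {-1<..<1}"
    hence y: "\<bar>y\<bar> < 1" by auto
    show "((\<lambda>x. F x * exp (- A x)) has_real_derivative 0) (at y)"
      by (rule derivative_eq_intros dA[OF y] dF[OF y] refl)+ (simp add: algebra_simps)
  qed (use assms in auto)
  have "F 0 * exp (- A 0) = 1"
    unfolding F_def A_def powser_zero by (simp add: exp_minus)
  with const have "F x * exp (- A x) = 1" by simp
  hence "F x = exp (A x)"
    by (simp add: exp_minus field_simps)
  moreover have "(\<lambda>n. B n * x ^ n) sums F x"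
    unfolding F_def by (intro summable_sums summable_norm_cancel[OF sum_B] assms)
  ultimately show ?thesis by (simp add: A_def)
qed

lemma b_eq_B: "b = B"
proof -
  have B: "\<forall>x\<in>{0<..<1}. (\<lambda>n. B n * x ^ n) sums exp (elliptic_K (sqrt x))"
  proof
    fix x :: real assume x: "x \<in> {0<..<1}"
    hence "(\<lambda>n. pi / 2 * (W n)\<^sup>2 * x ^ n) sums elliptic_K (sqrt x)"
      using elliptic_K_sums[of "sqrt x"] by auto
    thus "(\<lambda>n. B n * x ^ n) sums exp (elliptic_K (sqrt x))"
      using B_sums_exp[of x] x by (simp add: sums_iff)
  qed
  thus ?thesis
    unfolding b_def by (intro the_equality powser_eq_on_unit_interval) auto
qed

section \<open>Behaviour of K near 1\<close>

lemma elliptic_radicand_pos: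
  assumes "r \<in> {0<..<1::real}"
  shows "1 - r\<^sup>2 * (sin t)\<^sup>2 > 0"
proof -
  have "r\<^sup>2 * (sin t)\<^sup>2 \<le> r\<^sup>2 * 1"
    using abs_sin_le_one[of t] by (intro mult_left_mono) (auto simp: abs_square_le_1)
  also have "\<dots> < 1" using assms by (simp add: power_less_one_iff)
  finally show ?thesis by simp
qed

lemma elliptic_K_has_integral:
  assumes "r \<in> {0<..<1}"
  shows "((\<lambda>t. 1 / sqrt (1 - r\<^sup>2 * (sin t)\<^sup>2)) has_integral elliptic_K r) {0..pi/2}"
proof -
  have "continuous_on {0..pi/2} (\<lambda>t. 1 / sqrt (1 - r\<^sup>2 * (sin t)\<^sup>2))"
    using elliptic_radicand_pos[OF assms]
    by (intro continuous_intros) (metis less_irrefl real_sqrt_eq_zero_cancel_iff)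
  thus ?thesis
    unfolding elliptic_K_def by (intro integrable_integral integrable_continuous_interval)
qed

text \<open>
  This elementary integral carries the whole logarithmic singularity of \<open>K\<close> at \<open>1\<close>.
\<close>
lemma singular_part_integral:
  assumes "r \<in> {0<..<1}"
  shows "((\<lambda>t. r * sin t / sqrt (1 - r\<^sup>2 * (sin t)\<^sup>2)) has_integral ln ((1 + r) / sqrt (1 - r\<^sup>2))) {0..pi/2}"
proof -
  let ?D = "\<lambda>t. sqrt (1 - r\<^sup>2 * (sin t)\<^sup>2)"
  let ?F = "\<lambda>t. - ln (r * cos t + ?D t)"
  have D: "?D t > 0" for t using elliptic_radicand_pos[OF assms] by simp
  have "((\<lambda>t. r * sin t / ?D t) has_integral (?F (pi/2) - ?F 0)) {0..pi/2}"
  proof (rule fundamental_theorem_of_calculus)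
    fix t assume "t \<in> {0..pi/2}"
    hence "cos t \<ge> 0" by (intro cos_ge_zero) auto
    hence pos: "r * cos t + ?D t > 0"
      using D[of t] assms by (intro add_nonneg_pos mult_nonneg_nonneg) auto
    have "(?F has_real_derivative
        - ((- r * sin t + - (r\<^sup>2 * (2 * sin t * cos t)) / (2 * ?D t)) / (r * cos t + ?D t))) (at t)"
      using D[of t] pos elliptic_radicand_pos[OF assms, of t]
      by (auto intro!: derivative_eq_intros simp: divide_simps)
    also have "- ((- r * sin t + - (r\<^sup>2 * (2 * sin t * cos t)) / (2 * ?D t)) / (r * cos t + ?D t)) = r * sin t / ?D t"
    proof -
      have "- r * sin t + - (r\<^sup>2 * (2 * sin t * cos t)) / (2 * ?D t) = - (r * sin t / ?D t) * (r * cos t + ?D t)"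
        using D[of t] by (simp add: field_simps power2_eq_square)
      thus ?thesis using pos by simp
    qed
    finally show "(?F has_vector_derivative r * sin t / ?D t) (at t within {0..pi/2})"
      by (simp add: has_real_derivative_iff_has_vector_derivative has_vector_derivative_at_within)
  qed auto
  moreover have "?F (pi/2) - ?F 0 = ln ((1 + r) / sqrt (1 - r\<^sup>2))"
    using assms D[of "pi/2"] by (simp add: ln_div add_ac)
  ultimately show ?thesis by simp
qed

lemma regular_part_integral: "((\<lambda>t. cos t / (1 + sin t)) has_integral ln 2) {0..pi/2}"
proof -
  have "((\<lambda>t. cos t / (1 + sin t)) has_integral (ln (1 + sin (pi/2)) - ln (1 + sin 0))) {0..pi/2}"
  proof (rule fundamental_theorem_of_calculus)
    fix t :: real assume "t \<in> {0..pi/2}"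
    hence "sin t \<ge> 0" by (intro sin_ge_zero) auto
    hence "((\<lambda>t. ln (1 + sin t)) has_real_derivative cos t / (1 + sin t)) (at t)"
      by (auto intro!: derivative_eq_intros simp: divide_simps)
    thus "((\<lambda>t. ln (1 + sin t)) has_vector_derivative cos t / (1 + sin t)) (at t within {0..pi/2})"
      by (simp add: has_real_derivative_iff_has_vector_derivative has_vector_derivative_at_within)
  qed auto
  thus ?thesis by simp
qed

text \<open>
  Write \<open>D t = sqrt (1 - r\<^sup>2 * (sin t)\<^sup>2)\<close>. Subtracting the singular part \<open>r * sin t / D t\<close> from the integrands of \<open>K r\<close>
  and \<open>r * K r\<close> leaves \<open>(1 - r * sin t) / D t\<close> and \<open>r * (1 - sin t) / D t\<close>. Both agree with
  \<open>cos t / (1 + sin t)\<close> in the limit \<open>r = 1\<close>, and for \<open>r < 1\<close> they enclose it from above and below. Its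
  integral is \<open>ln 2\<close>.
\<close>
lemma elliptic_K_log_bounds:
  assumes r: "r \<in> {0<..<1}"
  shows "ln (2 * (1 + r) / sqrt (1 - r\<^sup>2)) \<le> elliptic_K r"
    and "r * elliptic_K r \<le> ln (2 * (1 + r) / sqrt (1 - r\<^sup>2))"
proof -
  let ?D = "\<lambda>t. sqrt (1 - r\<^sup>2 * (sin t)\<^sup>2)"
  have D: "?D t > 0" for t using elliptic_radicand_pos[OF assms] by simp
  have split: "ln ((1 + r) / sqrt (1 - r\<^sup>2)) + ln 2 = ln (2 * (1 + r) / sqrt (1 - r\<^sup>2))"
  proof -
    have "sqrt (1 - r\<^sup>2) > 0" using D[of "pi/2"] by simp
    hence "ln ((1 + r) / sqrt (1 - r\<^sup>2)) + ln 2 = ln ((1 + r) / sqrt (1 - r\<^sup>2) * 2)"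
      using r by (intro ln_mult_pos [symmetric]) auto
    thus ?thesis by (simp add: mult_ac)
  qed
  have int: "((\<lambda>t. r * sin t / ?D t + cos t / (1 + sin t)) has_integral ln (2 * (1 + r) / sqrt (1 - r\<^sup>2))) {0..pi/2}"
    using has_integral_add[OF singular_part_integral[OF r] regular_part_integral] unfolding split .
  show "ln (2 * (1 + r) / sqrt (1 - r\<^sup>2)) \<le> elliptic_K r"
  proof (rule has_integral_le[OF int elliptic_K_has_integral[OF r]])
    fix t assume t: "t \<in> {0..pi/2}"
    define s where "s = sin t"
    have s: "0 \<le> s" "s \<le> 1" using t by (auto simp: s_def intro!: sin_ge_zero)
    have c: "cos t \<ge> 0" using t by (intro cos_ge_zero) auto
    have rs: "0 \<le> r * s" "r * s \<le> s" using r s by (auto simp: mult_left_le_one_le)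
    have "cos t * ?D t \<le> (1 - r * s) * (1 + s)"
    proof (rule power2_le_imp_le)
      have "(cos t * ?D t)\<^sup>2 = (1 - s\<^sup>2) * (1 - (r * s)\<^sup>2)"
        using elliptic_radicand_pos[OF r, of t]
        by (simp add: power_mult_distrib cos_squared_eq s_def)
      also have "\<dots> = ((1 + s) * (1 - r * s)) * ((1 - s) * (1 + r * s))"
        by (simp add: power2_eq_square algebra_simps)
      also have "\<dots> \<le> ((1 + s) * (1 - r * s)) * ((1 + s) * (1 - r * s))"
      proof (rule mult_left_mono)
        have "(1 - s) * (1 + r * s) \<le> (1 - r * s) * (1 + s)"
          using s rs by (intro mult_mono) auto
        thus "(1 - s) * (1 + r * s) \<le> (1 + s) * (1 - r * s)" by (simp add: mult.commute)
      qed (use s rs in auto)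
      finally show "(cos t * ?D t)\<^sup>2 \<le> ((1 - r * s) * (1 + s))\<^sup>2"
        by (simp add: power2_eq_square mult_ac)
    qed (use s rs in auto)
    hence "cos t / (1 + s) \<le> (1 - r * s) / ?D t"
      using D[of t] s by (simp add: field_simps)
    thus "r * sin t / ?D t + cos t / (1 + sin t) \<le> 1 / ?D t"
      by (simp add: s_def diff_divide_distrib)
  qed
  show "r * elliptic_K r \<le> ln (2 * (1 + r) / sqrt (1 - r\<^sup>2))"
  proof (rule has_integral_le[OF has_integral_mult_right[OF elliptic_K_has_integral[OF r]] int])
    fix t assume t: "t \<in> {0..pi/2}"
    define s where "s = sin t"
    have s: "0 \<le> s" using t by (auto simp: s_def intro!: sin_ge_zero)
    have c: "cos t \<ge> 0" using t by (intro cos_ge_zero) auto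
    have "r * cos t \<le> ?D t"
    proof (rule real_le_rsqrt)
      have "(r * cos t)\<^sup>2 = r\<^sup>2 - r\<^sup>2 * (sin t)\<^sup>2"
        by (simp add: power_mult_distrib cos_squared_eq algebra_simps)
      moreover have "r\<^sup>2 \<le> 1" using r by (simp add: power_le_one)
      ultimately show "(r * cos t)\<^sup>2 \<le> 1 - r\<^sup>2 * (sin t)\<^sup>2" by simp
    qed
    hence "cos t * (r * cos t) \<le> cos t * ?D t"
      using c by (rule mult_left_mono)
    moreover have "cos t * (r * cos t) = r * (1 - s) * (1 + s)"
    proof -
      have "cos t * (r * cos t) = r * (cos t)\<^sup>2" by (simp add: power2_eq_square)
      also have "\<dots> = r * (1 - s\<^sup>2)" by (simp only: cos_squared_eq s_def)
      finally show ?thesis by (simp add: power2_eq_square algebra_simps)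
    qed
    ultimately have "r * (1 - s) / ?D t \<le> cos t / (1 + s)"
      using D[of t] s by (simp add: field_simps)
    thus "r * (1 / ?D t) \<le> r * sin t / ?D t + cos t / (1 + sin t)"
      by (simp add: s_def diff_divide_distrib algebra_simps)
  qed
qed

text \<open>
  The two logarithmic bounds differ by a factor \<open>1 / r\<close> only, so their gap is of order
  \<open>(1 - r) * ln (1 / (1 - r))\<close>, which is negligible against \<open>sqrt (1 - r\<^sup>2)\<close>. This precision is
  what survives the multiplication by the unbounded factor \<open>4 / sqrt (1 - r\<^sup>2)\<close> after exponentiation.
\<close>
lemma exp_elliptic_K_minus_pole_tendsto_0:
  "((\<lambda>r. exp (elliptic_K r) - 4 / sqrt (1 - r\<^sup>2)) \<longlongrightarrow> 0) (at_left 1)"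
proof (rule tendsto_sandwich)
  let ?Q = "\<lambda>r::real. 2 * (1 + r) / sqrt (1 - r\<^sup>2)"
  have ev: "\<forall>\<^sub>F r in at_left (1::real). r \<in> {0<..<1}"
    by (rule eventually_at_left_real) simp
  have Q: "?Q r > 0" if "r \<in> {0<..<1}" for r
    using that by (auto simp: power_less_one_iff)
  show "\<forall>\<^sub>F r in at_left 1. ?Q r - 4 / sqrt (1 - r\<^sup>2) \<le> exp (elliptic_K r) - 4 / sqrt (1 - r\<^sup>2)"
    using ev
  proof eventually_elim
    case (elim r)
    have "?Q r = exp (ln (?Q r))" using Q[OF elim] by simp
    also have "\<dots> \<le> exp (elliptic_K r)" using elliptic_K_log_bounds(1)[OF elim] by simp
    finally show ?case by simp
  qed
  show "\<forall>\<^sub>F r in at_left 1. exp (elliptic_K r) - 4 / sqrt (1 - r\<^sup>2) \<le> exp (ln (?Q r) / r) - 4 / sqrt (1 - r\<^sup>2)"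
    using ev
  proof eventually_elim
    case (elim r)
    thus ?case using elliptic_K_log_bounds(2)[OF elim] by (simp add: pos_le_divide_eq mult_ac)
  qed
  show "((\<lambda>r. ?Q r - 4 / sqrt (1 - r\<^sup>2)) \<longlongrightarrow> 0) (at_left 1)"
    by real_asymp
  show "((\<lambda>r. exp (ln (?Q r) / r) - 4 / sqrt (1 - r\<^sup>2)) \<longlongrightarrow> 0) (at_left 1)"
    by real_asymp
qed

section \<open>The sign of the differences and the sharp bounds\<close>

lemma c_eq: "c n = B n - 4 * W n"
  by (simp add: c_def b_eq_B)

lemma c_minus_W_sums:
  assumes "r \<in> {0<..<1}"
  shows "(\<lambda>n. (B n - q * W n) * (r\<^sup>2) ^ n) sums (exp (elliptic_K r) - q / sqrt (1 - r\<^sup>2))"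
proof -
  have x: "\<bar>r\<^sup>2\<bar> < 1" using assms by (simp add: power_less_one_iff)
  have "(\<lambda>n. B n * (r\<^sup>2) ^ n) sums exp (elliptic_K r)"
    using B_sums_exp[OF x] elliptic_K_sums[OF assms] by (simp add: sums_iff)
  moreover have "(\<lambda>n. q * (W n * (r\<^sup>2) ^ n)) sums (q * (1 / sqrt (1 - r\<^sup>2)))"
    by (intro sums_mult W_sums x)
  ultimately show ?thesis
    using sums_diff by (fastforce simp: algebra_simps)
qed

text \<open>
  If \<open>B N \<ge> 4 * W N\<close> held for some \<open>N \<ge> 1\<close>, the strict growth of \<open>B n / W n\<close> would give \<open>q > 4\<close> with
  \<open>B n \<ge> q * W n\<close> for all larger \<open>n\<close>. Then \<open>exp K\<close> would exceed \<open>q / sqrt (1 - r\<^sup>2)\<close> up to a bounded error, against its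
  asymptotic behaviour \<open>4 / sqrt (1 - r\<^sup>2)\<close>.
\<close>
lemma c_neg:
  assumes "N \<ge> 1"
  shows "c N < 0"
proof (rule ccontr)
  assume "\<not> c N < 0"
  hence ge4: "4 * W N \<le> B N" by (simp add: c_eq)
  have increase: "B n / W n < B (Suc n) / W (Suc n)" if "n \<ge> 1" for n
    using B_ratio_gt[OF that] W_pos[of n] B_pos[of n]
    by (simp add: W_Suc divide_simps) (simp add: algebra_simps)
  define q where "q = B (Suc N) / W (Suc N)"
  have "4 \<le> B N / W N" using ge4 W_pos[of N] by (simp add: field_simps)
  also have "\<dots> < q" unfolding q_def by (rule increase[OF assms])
  finally have q: "q > 4" .
  have ratio: "q * W n \<le> B n" if "n \<ge> Suc N" for n
  proof -
    have "q \<le> B n / W n"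
      using that
    proof (induction n rule: dec_induct)
      case (step n)
      thus ?case using increase[of n] by linarith
    qed (simp add: q_def)
    thus ?thesis using W_pos[of n] by (simp add: field_simps)
  qed
  define C where "C = (\<Sum>n<Suc N. \<bar>B n - q * W n\<bar>)"
  have lower: "exp (elliptic_K r) - q / sqrt (1 - r\<^sup>2) \<ge> - C" if r: "r \<in> {0<..<1}" for r
  proof -
    let ?t = "\<lambda>n. (B n - q * W n) * (r\<^sup>2) ^ n"
    note sums = c_minus_W_sums[OF r, of q]
    have "- C \<le> - \<bar>\<Sum>n<Suc N. ?t n\<bar>"
    proof -
      have "\<bar>\<Sum>n<Suc N. ?t n\<bar> \<le> (\<Sum>n<Suc N. \<bar>?t n\<bar>)" by (rule sum_abs)
      also have "\<dots> \<le> C"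
        unfolding C_def using r by (intro sum_mono) (auto simp: abs_mult mult_left_le power_le_one)
      finally show ?thesis by simp
    qed
    also have "\<dots> \<le> (\<Sum>n<Suc N. ?t n)" by simp
    also have "\<dots> \<le> suminf ?t"
      using ratio by (intro sum_le_suminf sums_summable[OF sums]) auto
    finally show ?thesis using sums by (simp add: sums_iff)
  qed
  have "filterlim (\<lambda>r::real. 1 / sqrt (1 - r\<^sup>2)) at_top (at_left 1)"
    by real_asymp
  hence "filterlim (\<lambda>r. (4 - q) * (1 / sqrt (1 - r\<^sup>2))) at_bot (at_left 1)"
    using q by (intro filterlim_tendsto_neg_mult_at_bot[OF tendsto_const]) auto
  hence "filterlim (\<lambda>r. (4 - q) / sqrt (1 - r\<^sup>2)) at_bot (at_left 1)" by simp
  hence "\<forall>\<^sub>F r in at_left 1. (4 - q) / sqrt (1 - r\<^sup>2) < - C - 1"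
    by (simp add: filterlim_at_bot_dense)
  moreover have "\<forall>\<^sub>F r in at_left 1. exp (elliptic_K r) - 4 / sqrt (1 - r\<^sup>2) < 1"
    by (rule order_tendstoD(2)[OF exp_elliptic_K_minus_pole_tendsto_0]) simp
  moreover have "\<forall>\<^sub>F r in at_left (1::real). r \<in> {0<..<1}"
    by (rule eventually_at_left_real) simp
  ultimately have "\<forall>\<^sub>F r in at_left (1::real). False"
  proof eventually_elim
    case (elim r)
    thus ?case using lower[of r] by (simp add: diff_divide_distrib)
  qed
  thus False by simp
qed

definition tail :: "nat \<Rightarrow> real \<Rightarrow> real" where
  "tail k r = (exp (elliptic_K r) - 4 / sqrt (1 - r\<^sup>2) - (\<Sum>n<k. c n * (r\<^sup>2) ^ n)) / (r\<^sup>2) ^ k"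

lemma tail_sums:
  assumes "r \<in> {0<..<1}"
  shows "(\<lambda>n. c (n + k) * (r\<^sup>2) ^ n) sums tail k r"
proof -
  have "(\<lambda>n. c n * (r\<^sup>2) ^ n) sums (exp (elliptic_K r) - 4 / sqrt (1 - r\<^sup>2))"
    using c_minus_W_sums[OF assms, of 4] by (simp add: c_eq)
  thus ?thesis
    unfolding tail_def using assms by (intro powser_sums_tail) auto
qed

lemma exp_elliptic_K_eq_tail:
  assumes "r \<in> {0<..<1}"
  shows "exp (elliptic_K r) = 4 / sqrt (1 - r\<^sup>2) + (\<Sum>n<k. c n * r ^ (2 * n)) + tail k r * r ^ (2 * k)"
  using assms by (simp add: tail_def power_mult)

lemma tail_strict_antimono:
  assumes "0 < r" "r < s" "s < 1" "k \<ge> 1"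
  shows "tail k s < tail k r"
proof -
  have c: "c (n + k) < 0" for n using assms by (intro c_neg) auto
  let ?d = "\<lambda>n. c (n + k) * (r\<^sup>2) ^ n - c (n + k) * (s\<^sup>2) ^ n"
  have sums: "?d sums (tail k r - tail k s)"
    using assms by (intro sums_diff tail_sums) auto
  have sq: "r\<^sup>2 < s\<^sup>2" using assms by (intro power_strict_mono) auto
  have "?d n \<ge> 0" for n
    using c[of n] power_mono[of "r\<^sup>2" "s\<^sup>2" n] sq by (auto intro!: mult_left_mono_neg)
  moreover have "?d 1 > 0"
    using c[of 1] sq by (auto intro!: mult_strict_left_mono_neg)
  ultimately have "suminf ?d > 0"
    using sums by (intro suminf_pos2[where i = 1]) (auto simp: sums_iff)
  thus ?thesis using sums by (simp add: sums_iff)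
qed

lemma tail_neg:
  assumes "r \<in> {0<..<1}" "k \<ge> 1"
  shows "tail k r < 0"
proof -
  have c: "c (n + k) < 0" for n using assms by (intro c_neg) auto
  let ?d = "\<lambda>n. - (c (n + k) * (r\<^sup>2) ^ n)"
  have sums: "?d sums (- tail k r)"
    using assms by (intro sums_minus tail_sums)
  have "suminf ?d > 0"
    using sums assms c by (intro suminf_pos) (auto simp: sums_iff mult_neg_pos)
  thus ?thesis using sums by (simp add: sums_iff)
qed

lemma tail_tendsto_at_1: "(tail k \<longlongrightarrow> - (\<Sum>n<k. c n)) (at_left 1)"
proof -
  have "(tail k \<longlongrightarrow> (0 - (\<Sum>n<k. c n * (1\<^sup>2) ^ n)) / (1\<^sup>2) ^ k) (at_left 1)"
    unfolding tail_def
    by (intro tendsto_intros exp_elliptic_K_minus_pole_tendsto_0) auto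
  thus ?thesis by simp
qed

text \<open>
  All coefficients of the tail are negative, so it decreases strictly towards its limit at \<open>1\<close>.
\<close>
lemma tail_gt_limit:
  assumes "r \<in> {0<..<1}" "k \<ge> 1"
  shows "- (\<Sum>n<k. c n) < tail k r"
proof -
  define s where "s = (r + 1) / 2"
  have s: "r < s" "s < 1" using assms by (auto simp: s_def)
  have "\<forall>\<^sub>F t in at_left 1. t \<in> {s<..<1}"
    using s by (intro eventually_at_left_real)
  hence "\<forall>\<^sub>F t in at_left 1. tail k t \<le> tail k s"
    by eventually_elim (use s assms in \<open>auto intro!: less_imp_le[OF tail_strict_antimono]\<close>)
  hence "- (\<Sum>n<k. c n) \<le> tail k s"
    using tail_tendsto_at_1 by (intro tendsto_upperbound[of "tail k" _ "at_left 1"]) auto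
  also have "\<dots> < tail k r" using s assms by (intro tail_strict_antimono) auto
  finally show ?thesis .
qed

lemma c_partial_sum_nonneg:
  assumes "k \<ge> 1"
  shows "(\<Sum>n<k. c n) \<ge> 0"
proof -
  have "- (\<Sum>n<k. c n) < tail k (1/2)" using assms by (intro tail_gt_limit) auto
  also have "\<dots> < 0" using assms by (intro tail_neg) auto
  finally show ?thesis by simp
qed

text \<open>
  Only the constant coefficient can be positive, and its monomial does not depend on \<open>r\<close>.
  Together with \<open>c_partial_sum_nonneg\<close> this makes the argument of the logarithm in the lower bound positive.
\<close>
lemma c_partial_sum_le_polynomial:
  assumes "r \<in> {0<..<1}"
  shows "(\<Sum>n<k. c n) \<le> (\<Sum>n<k. c n * r ^ (2 * n))"
proof (rule sum_mono)
  fix n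
  show "c n \<le> c n * r ^ (2 * n)"
  proof (cases "n = 0")
    case False
    hence "c n < 0" by (intro c_neg) auto
    moreover have "r ^ (2 * n) \<le> 1" using assms by (intro power_le_one) auto
    ultimately show ?thesis using mult_left_mono_neg[of "r ^ (2 * n)" 1 "c n"] by simp
  qed auto
qed

lemma tail_tendsto_at_0: "(tail k \<longlongrightarrow> c k) (at_right 0)"
proof -
  have "((\<lambda>x. tail k (sqrt x)) \<longlongrightarrow> c (0 + k)) (at_right 0)"
    using tail_sums[of "sqrt _" k] by (intro powser_tendsto_at_right_0) auto
  moreover have "filterlim (\<lambda>r::real. r\<^sup>2) (at_right 0) (at_right 0)"
    by real_asymp
  ultimately have "((\<lambda>r. tail k (sqrt (r\<^sup>2))) \<longlongrightarrow> c k) (at_right 0)"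
    using filterlim_compose[of "\<lambda>x. tail k (sqrt x)"] by fastforce
  moreover have "\<forall>\<^sub>F r in at_right (0::real). tail k (sqrt (r\<^sup>2)) = tail k r"
    using eventually_at_right_less[of "0::real"] by eventually_elim simp
  ultimately show ?thesis by (rule Lim_transform_eventually)
qed

theorem proposition2:
  fixes m :: nat
  shows
    "(\<forall>r\<in>{0<..<1::real}.
        0 < 4 / sqrt (1 - r\<^sup>2) + (\<Sum>n=0..m. c n * r ^ (2 * n)) - (\<Sum>n=0..m. c n) * r ^ (2 * m + 2) \<and>
        ln (4 / sqrt (1 - r\<^sup>2) + (\<Sum>n=0..m. c n * r ^ (2 * n)) - (\<Sum>n=0..m. c n) * r ^ (2 * m + 2))
          < elliptic_K r \<and>
        0 < 4 / sqrt (1 - r\<^sup>2) + (\<Sum>n=0..m+1. c n * r ^ (2 * n)) \<and>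
        elliptic_K r < ln (4 / sqrt (1 - r\<^sup>2) + (\<Sum>n=0..m+1. c n * r ^ (2 * n))))
     \<and> (\<forall>q::real. q > - (\<Sum>n=0..m. c n) \<longrightarrow>
        \<not> (\<forall>r\<in>{0<..<1::real}.
             ln (4 / sqrt (1 - r\<^sup>2) + (\<Sum>n=0..m. c n * r ^ (2 * n)) + q * r ^ (2 * m + 2))
               < elliptic_K r))
     \<and> (\<forall>p::real. p < c (m + 1) \<longrightarrow>
        \<not> (\<forall>r\<in>{0<..<1::real}.
             elliptic_K r
               < ln (4 / sqrt (1 - r\<^sup>2) + (\<Sum>n=0..m. c n * r ^ (2 * n)) + p * r ^ (2 * m + 2))))"
proof -
  define k where "k = Suc m"
  have k: "k \<ge> 1" by (simp add: k_def)
  define P where "P = (\<lambda>r. \<Sum>n<k. c n * r ^ (2 * n))"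
  define S where "S = (\<Sum>n<k. c n)"
  define pole where "pole = (\<lambda>r::real. 4 / sqrt (1 - r\<^sup>2))"
  have P_eq: "(\<Sum>n=0..m. c n * r ^ (2 * n)) = P r" for r
    by (simp add: P_def k_def lessThan_Suc_atMost atLeast0AtMost)
  have P_Suc_eq: "(\<Sum>n=0..k. c n * r ^ (2 * n)) = (\<Sum>n<Suc k. c n * r ^ (2 * n))" for r
    by (simp only: lessThan_Suc_atMost atLeast0AtMost)
  have S_eq: "(\<Sum>n=0..m. c n) = S"
    by (simp add: S_def k_def lessThan_Suc_atMost atLeast0AtMost)
  have pole_eq: "4 / sqrt (1 - r\<^sup>2) = pole r" for r
    by (simp add: pole_def)
  have pole_pos: "pole r > 0" if "r \<in> {0<..<1}" for r
    using that by (auto simp: pole_def power_less_one_iff)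
  have expK: "exp (elliptic_K r) = pole r + P r + tail k r * r ^ (2 * k)" if "r \<in> {0<..<1}" for r
    unfolding pole_def P_def by (rule exp_elliptic_K_eq_tail[OF that])

  have lower: "0 < pole r + P r - S * r ^ (2 * k)"
      "ln (pole r + P r - S * r ^ (2 * k)) < elliptic_K r" if r: "r \<in> {0<..<1}" for r
  proof -
    have "S * r ^ (2 * k) \<le> S"
      using c_partial_sum_nonneg[OF k] r by (auto simp: S_def intro!: mult_left_le power_le_one)
    also have "S \<le> P r"
      unfolding S_def P_def by (rule c_partial_sum_le_polynomial[OF r])
    finally show pos: "0 < pole r + P r - S * r ^ (2 * k)"
      using pole_pos[OF r] by linarith
    have "- S * r ^ (2 * k) < tail k r * r ^ (2 * k)"
      using tail_gt_limit[OF r k] r by (intro mult_strict_right_mono) (auto simp: S_def)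
    hence "pole r + P r - S * r ^ (2 * k) < exp (elliptic_K r)"
      using expK[OF r] by simp
    thus "ln (pole r + P r - S * r ^ (2 * k)) < elliptic_K r"
      using pos by (metis exp_gt_zero ln_exp ln_less_cancel_iff)
  qed

  have upper: "0 < pole r + (\<Sum>n<Suc k. c n * r ^ (2 * n))"
      "elliptic_K r < ln (pole r + (\<Sum>n<Suc k. c n * r ^ (2 * n)))" if r: "r \<in> {0<..<1}" for r
  proof -
    have "tail (Suc k) r * r ^ (2 * Suc k) < 0"
      using tail_neg[OF r, of "Suc k"] r by (intro mult_neg_pos) auto
    hence *: "exp (elliptic_K r) < pole r + (\<Sum>n<Suc k. c n * r ^ (2 * n))"
      using exp_elliptic_K_eq_tail[OF r, of "Suc k"] unfolding pole_def by linarith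
    thus "0 < pole r + (\<Sum>n<Suc k. c n * r ^ (2 * n))"
      by (rule less_trans[OF exp_gt_zero])
    with * show "elliptic_K r < ln (pole r + (\<Sum>n<Suc k. c n * r ^ (2 * n)))"
      by (metis exp_gt_zero ln_exp ln_less_cancel_iff)
  qed

  have lower_sharp: "\<exists>r\<in>{0<..<1}. elliptic_K r < ln (pole r + P r + q * r ^ (2 * k))" if "q > - S" for q
  proof -
    have "\<forall>\<^sub>F r in at_left 1. tail k r < q"
      using tail_tendsto_at_1 that unfolding S_def by (rule order_tendstoD(2))
    moreover have "\<forall>\<^sub>F r in at_left (1::real). r \<in> {0<..<1}"
      by (rule eventually_at_left_real) simp
    ultimately have "\<forall>\<^sub>F r in at_left (1::real). tail k r < q \<and> r \<in> {0<..<1}"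
      by eventually_elim simp
    then obtain r where tail: "tail k r < q" and r: "r \<in> {0<..<1}"
      using eventually_happens[of _ "at_left (1::real)"] by auto
    have "tail k r * r ^ (2 * k) < q * r ^ (2 * k)"
      using tail r by (intro mult_strict_right_mono) auto
    hence "exp (elliptic_K r) < pole r + P r + q * r ^ (2 * k)"
      using expK[OF r] by linarith
    hence "elliptic_K r < ln (pole r + P r + q * r ^ (2 * k))"
      by (metis exp_gt_zero less_trans ln_exp ln_less_cancel_iff)
    with r show ?thesis by blast
  qed

  have upper_sharp: "\<exists>r\<in>{0<..<1}. ln (pole r + P r + p * r ^ (2 * k)) < elliptic_K r" if "p < c k" for p
  proof -
    have "\<forall>\<^sub>F r in at_right 0. p < tail k r"
      using tail_tendsto_at_0 that by (rule order_tendstoD(1))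
    moreover have "\<forall>\<^sub>F r in at_right (0::real). r \<in> {0<..<1}"
      by (rule eventually_at_right_real) simp
    \<comment> \<open>\<open>ln\<close> is monotone on positive arguments only; near \<open>0\<close> the argument is close to \<open>4 + c 0 = B 0 > 0\<close>\<close>
    moreover have "\<forall>\<^sub>F r in at_right 0. 0 < pole r + P r + p * r ^ (2 * k)"
    proof -
      have "((\<lambda>r. pole r + P r + p * r ^ (2 * k)) \<longlongrightarrow> pole 0 + P 0 + p * 0 ^ (2 * k)) (at_right 0)"
        unfolding pole_def P_def by (intro tendsto_intros) auto
      moreover have "P 0 = c 0"
        by (simp add: P_def k_def lessThan_Suc_eq_insert_0 sum.reindex power_0_left)
      ultimately have "((\<lambda>r. pole r + P r + p * r ^ (2 * k)) \<longlongrightarrow> B 0) (at_right 0)"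
        using k by (simp add: pole_def c_eq power_0_left)
      thus ?thesis using B_pos[of 0] by (rule order_tendstoD(1))
    qed
    ultimately have "\<forall>\<^sub>F r in at_right (0::real). p < tail k r \<and> r \<in> {0<..<1} \<and> 0 < pole r + P r + p * r ^ (2 * k)"
      by eventually_elim simp
    then obtain r where tail: "p < tail k r" and r: "r \<in> {0<..<1}" and pos: "0 < pole r + P r + p * r ^ (2 * k)"
      using eventually_happens[of _ "at_right (0::real)"] by auto
    have "p * r ^ (2 * k) < tail k r * r ^ (2 * k)"
      using tail r by (intro mult_strict_right_mono) auto
    hence "pole r + P r + p * r ^ (2 * k) < exp (elliptic_K r)"
      using expK[OF r] by linarith
    hence "ln (pole r + P r + p * r ^ (2 * k)) < elliptic_K r"
      using pos by (metis exp_gt_zero ln_exp ln_less_cancel_iff)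
    with r show ?thesis by blast
  qed

  have exponent: "2 * m + 2 = 2 * k" and index: "m + 1 = k"
    by (simp_all add: k_def)
  show ?thesis
    unfolding P_Suc_eq P_eq S_eq exponent index pole_eq
    using lower upper lower_sharp upper_sharp by (meson less_asym)
qed

end
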